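(* Let $(a_i)_{i \geq 1}$ be a sequence of positive real numbers converging to $0$, with $\sum_{i=1}^\infty a_i = \infty$. Let $X$ be the closed convex hull in $\ell_1$ of the set $\{a_1 e_1, a_2 e_2, \ldots\}$, where $e_i$ is the $i$th standard basis vector, equipped with the subspace metric from $\ell_1$. Then the metric space $X$ is compact and of negative type, and $|tX| = \infty$ for all $t > 0$, where $|\cdot|$ denotes magnitude.
   Context: $\ell_1$ is the space of real sequences $(x_i)_{i\ge 1}$ with finite $1$-norm $\sum |x_i|$, with the metric induced by the $1$-norm, and $e_i = (0,\ldots,0,1,0,\ldots)$ is its $i$th standard basis vector. Equivalently, $X = \{(x_1, x_2, \ldots) : x_i \geq 0 \text{ for all } i,\ \sum_i x_i/a_i \leq 1\}$. For a finite metric space $A$, let $Z_A$ be the matrix $(e^{-d(a,b)})_{a,b\in A}$. If $Z_A$ is invertible, the magnitude $|A|$ is the sum of all the entries of $Z_A^{-1}$. A compact metric space $X$ is positive definite if $Z_A$ is positive definite for every finite $A \subseteq X$; its magnitude is then $|X| = \sup\{|A| : A \subseteq X \text{ finite}\} \in [0,\infty]$. For a metric space $X$ and $t>0$, $tX$ denotes $X$ with the rescaled metric $t\,d_X$. A compact metric space $X$ is of negative type if $tX$ is positive definite for all $t>0$. *)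

theory Defs
  imports "HOL-Analysis.Analysis"
begin

section \<open>The normed space \<open>\<ell>\<^sub>1\<close>\<close>

text \<open>Coordinates are indexed from \<open>0\<close>.\<close>

typedef ell1 = "{x :: nat \<Rightarrow> real. summable (\<lambda>i. \<bar>x i\<bar>)}"
  morphisms coord Abs_ell1
  by (rule exI[of _ "\<lambda>_. 0"]) simp

setup_lifting type_definition_ell1

lemma summable_coord: "summable (\<lambda>i. \<bar>coord x i\<bar>)"
  using coord[of x] by simp

lemma ell1_eqI: "(\<And>i. coord x i = coord y i) \<Longrightarrow> x = y"
  by (simp add: coord_inject[symmetric] fun_eq_iff)

lemma summable_abs_add:
  fixes f g :: "nat \<Rightarrow> real"
  assumes "summable (\<lambda>i. \<bar>f i\<bar>)" and "summable (\<lambda>i. \<bar>g i\<bar>)"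
  shows "summable (\<lambda>i. \<bar>f i + g i\<bar>)"
  by (rule summable_comparison_test[OF _ summable_add[OF assms]]) (auto intro: abs_triangle_ineq)

instantiation ell1 :: real_vector
begin

lift_definition zero_ell1 :: ell1 is "\<lambda>_. 0" by simp

lift_definition plus_ell1 :: "ell1 \<Rightarrow> ell1 \<Rightarrow> ell1" is "\<lambda>x y i. x i + y i"
  by (rule summable_abs_add)

lift_definition uminus_ell1 :: "ell1 \<Rightarrow> ell1" is "\<lambda>x i. - x i" by simp

lift_definition minus_ell1 :: "ell1 \<Rightarrow> ell1 \<Rightarrow> ell1" is "\<lambda>x y i. x i - y i"
  using summable_abs_add[of _ "\<lambda>i. - _ i"] by simp

lift_definition scaleR_ell1 :: "real \<Rightarrow> ell1 \<Rightarrow> ell1" is "\<lambda>c x i. c * x i"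
  by (simp add: abs_mult summable_mult)

instance
  by standard (transfer; simp add: fun_eq_iff algebra_simps)+

end

instantiation ell1 :: real_normed_vector
begin

lift_definition norm_ell1 :: "ell1 \<Rightarrow> real" is "\<lambda>x. \<Sum>i. \<bar>x i\<bar>" .

definition dist_ell1 :: "ell1 \<Rightarrow> ell1 \<Rightarrow> real"
  where "dist_ell1 x y = norm (x - y)"

definition sgn_ell1 :: "ell1 \<Rightarrow> ell1"
  where "sgn_ell1 x = x /\<^sub>R norm x"

definition uniformity_ell1 :: "(ell1 \<times> ell1) filter"
  where "uniformity_ell1 = (INF e\<in>{0<..}. principal {(x, y). dist x y < e})"

definition open_ell1 :: "ell1 set \<Rightarrow> bool"
  where "open_ell1 U = (\<forall>x\<in>U. \<forall>\<^sub>F (x', y) in uniformity. x' = x \<longrightarrow> y \<in> U)"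

instance
proof
  fix x y :: ell1 and c :: real
  show "dist x y = norm (x - y)" by (rule dist_ell1_def)
  show "sgn x = x /\<^sub>R norm x" by (rule sgn_ell1_def)
  show "norm x = 0 \<longleftrightarrow> x = 0"
    by transfer (auto simp: suminf_eq_zero_iff fun_eq_iff)
  show "norm (x + y) \<le> norm x + norm y"
  proof transfer
    fix f g :: "nat \<Rightarrow> real"
    assume fg: "summable (\<lambda>i. \<bar>f i\<bar>)" "summable (\<lambda>i. \<bar>g i\<bar>)"
    have "(\<Sum>i. \<bar>f i + g i\<bar>) \<le> (\<Sum>i. \<bar>f i\<bar> + \<bar>g i\<bar>)"
      by (rule suminf_le) (auto intro: abs_triangle_ineq summable_abs_add summable_add fg)
    also have "\<dots> = (\<Sum>i. \<bar>f i\<bar>) + (\<Sum>i. \<bar>g i\<bar>)"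
      by (rule suminf_add[symmetric]) (fact fg)+
    finally show "(\<Sum>i. \<bar>f i + g i\<bar>) \<le> (\<Sum>i. \<bar>f i\<bar>) + (\<Sum>i. \<bar>g i\<bar>)" .
  qed
  show "norm (c *\<^sub>R x) = \<bar>c\<bar> * norm x"
    by transfer (simp add: abs_mult suminf_mult)
qed (rule uniformity_ell1_def open_ell1_def)+

end

lift_definition unit_ell1 :: "nat \<Rightarrow> ell1" is "\<lambda>i j. if j = i then 1 else 0"
  by (rule summable_finite[of "{_}"]) auto


section \<open>Magnitude\<close>

text \<open>A matrix with rows and columns indexed by a finite set \<open>A\<close> is a function of two arguments,
  of which only the values on \<open>A \<times> A\<close> are relevant.\<close>

definition inverse_on :: "'a set \<Rightarrow> ('a \<Rightarrow> 'a \<Rightarrow> real) \<Rightarrow> ('a \<Rightarrow> 'a \<Rightarrow> real) \<Rightarrow> bool"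
  where "inverse_on A Z W \<longleftrightarrow>
    (\<forall>a\<in>A. \<forall>b\<in>A. (\<Sum>c\<in>A. Z a c * W c b) = (if a = b then 1 else 0)
                \<and> (\<Sum>c\<in>A. W a c * Z c b) = (if a = b then 1 else 0))"

lemma inverse_on_unique:
  assumes A: "finite A" and W: "inverse_on A Z W" and W': "inverse_on A Z W'"
    and a: "a \<in> A" and b: "b \<in> A"
  shows "W a b = W' a b"
proof -
  have "W a b = (\<Sum>c\<in>A. W a c * (if c = b then 1 else 0))"
    using A b by (simp add: if_distrib sum.delta cong: if_cong)
  also have "\<dots> = (\<Sum>c\<in>A. W a c * (\<Sum>d\<in>A. Z c d * W' d b))"
    using W' b by (intro sum.cong) (auto simp: inverse_on_def)
  also have "\<dots> = (\<Sum>c\<in>A. \<Sum>d\<in>A. W a c * Z c d * W' d b)"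
    by (simp add: sum_distrib_left mult.assoc)
  also have "\<dots> = (\<Sum>d\<in>A. \<Sum>c\<in>A. W a c * Z c d * W' d b)"
    by (rule sum.swap)
  also have "\<dots> = (\<Sum>d\<in>A. (\<Sum>c\<in>A. W a c * Z c d) * W' d b)"
    by (simp add: sum_distrib_right)
  also have "\<dots> = (\<Sum>d\<in>A. (if a = d then 1 else 0) * W' d b)"
    using W a by (intro sum.cong) (auto simp: inverse_on_def)
  also have "\<dots> = W' a b"
    using A a by (simp add: if_distribR if_distrib[of "\<lambda>x. x * _"] sum.delta' cong: if_cong)
  finally show ?thesis .
qed

definition pos_def_on :: "'a set \<Rightarrow> ('a \<Rightarrow> 'a \<Rightarrow> real) \<Rightarrow> bool"
  where "pos_def_on A Z \<longleftrightarrow>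
    (\<forall>a\<in>A. \<forall>b\<in>A. Z a b = Z b a) \<and>
    (\<forall>v. (\<exists>a\<in>A. v a \<noteq> 0) \<longrightarrow> (\<Sum>a\<in>A. \<Sum>b\<in>A. v a * Z a b * v b) > 0)"

definition similarity_matrix :: "'a metric \<Rightarrow> 'a \<Rightarrow> 'a \<Rightarrow> real"
  where "similarity_matrix m a b = exp (- mdist m a b)"

text \<open>The magnitude of a finite subset \<open>A\<close> of a metric space. It is meaningful only if the
  similarity matrix of \<open>A\<close> is invertible, in which case lemma \<open>inverse_on_unique\<close> shows
  that it does not depend on the choice of inverse.\<close>

definition finite_magnitude :: "'a metric \<Rightarrow> 'a set \<Rightarrow> real"
  where "finite_magnitude m A =
    (let W = SOME W. inverse_on A (similarity_matrix m) W in \<Sum>a\<in>A. \<Sum>b\<in>A. W a b)"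

text \<open>The next three notions are intended for compact spaces; compactness is not part of them.\<close>

definition positive_definite_space :: "'a metric \<Rightarrow> bool"
  where "positive_definite_space m \<longleftrightarrow>
    (\<forall>A. finite A \<and> A \<subseteq> mspace m \<longrightarrow> pos_def_on A (similarity_matrix m))"

text \<open>For positive definite spaces. The supremum is never negative, since the empty set has
  magnitude \<open>0\<close>.\<close>

definition magnitude :: "'a metric \<Rightarrow> ereal"
  where "magnitude m = (SUP A\<in>{A. finite A \<and> A \<subseteq> mspace m}. ereal (finite_magnitude m A))"

text \<open>The space \<open>tX\<close>, for \<open>t > 0\<close>.\<close>

definition rescale :: "real \<Rightarrow> 'a metric \<Rightarrow> 'a metric"
  where "rescale t m = metric (mspace m, \<lambda>x y. t * mdist m x y)"

lemma
  assumes "t > 0"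
  shows mspace_rescale: "mspace (rescale t m) = mspace m"
    and mdist_rescale: "mdist (rescale t m) x y = t * mdist m x y"
proof -
  interpret M: Metric_space "mspace m" "mdist m"
    by (rule Metric_space_mspace_mdist)
  interpret T: Metric_space "mspace m" "\<lambda>x y. t * mdist m x y"
    using assms
    by unfold_locales
      (auto simp: M.commute M.triangle simp flip: distrib_left)
  show "mspace (rescale t m) = mspace m" "mdist (rescale t m) x y = t * mdist m x y"
    by (simp_all add: rescale_def T.mspace_metric T.mdist_metric)
qed

definition negative_type :: "'a metric \<Rightarrow> bool"
  where "negative_type m \<longleftrightarrow> (\<forall>t>0. positive_definite_space (rescale t m))"

end

theory Submission
  imports Defs
begin

text \<open>Compactness: the hull lies in the image of \<open>{b. b \<ge> 0 \<and> \<Sum>b \<le> 1}\<close>, which is compact in the product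
  topology, under \<open>b \<mapsto> (a\<^sub>i b\<^sub>i)\<close>, which is continuous into \<open>\<ell>\<^sub>1\<close> as a uniform limit of its truncations
  because \<open>a \<longlonglongrightarrow> 0\<close>.

  Negative type: \<open>exp (- \<bar>r - s\<bar>)\<close> is a positive combination of rank-one kernels on any finite set of
  reals. Multiplying over the coordinates and passing to the limit gives positive semidefiniteness of
  \<open>exp (- \<parallel>x - y\<parallel>)\<close> on \<open>\<ell>\<^sub>1\<close>; strictness follows by induction on the support of the vector.

  Infinite magnitude: the points \<open>0, a\<^sub>1 e\<^sub>1, \<dots>, a\<^sub>n e\<^sub>n\<close> are the vertices of a weighted star, since
  \<open>a\<^sub>i e\<^sub>i\<close> and \<open>a\<^sub>j e\<^sub>j\<close> are at distance \<open>a\<^sub>i + a\<^sub>j\<close>. The inverse of its similarity matrix is explicit, and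
  its magnitude after scaling by \<open>t\<close> is \<open>1 + \<Sum>\<^sub>i tanh (t a\<^sub>i / 2)\<close>, which diverges with \<open>\<Sum>a\<^sub>i\<close>.\<close>

section \<open>Quadratic forms and the kernel \<open>exp (- \<bar>r - s\<bar>)\<close> on the real
  line\<close>

definition qform :: "'a set \<Rightarrow> ('a \<Rightarrow> 'a \<Rightarrow> real) \<Rightarrow> ('a \<Rightarrow> real) \<Rightarrow> real"
  where "qform A Z v = (\<Sum>x\<in>A. \<Sum>y\<in>A. v x * Z x y * v y)"

lemma qform_cong:
  assumes "\<And>x y. x \<in> A \<Longrightarrow> y \<in> A \<Longrightarrow> v x * Z x y * v y = w x * Y x y * w y"
  shows "qform A Z v = qform A Y w"
  unfolding qform_def by (intro sum.cong refl assms)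

lemma qform_support:
  assumes "finite A" "B \<subseteq> A" "\<And>x. x \<in> A - B \<Longrightarrow> v x = 0"
  shows "qform A Z v = qform B Z v"
proof -
  have "qform A Z v = (\<Sum>x\<in>A. \<Sum>y\<in>B. v x * Z x y * v y)"
    unfolding qform_def using assms by (intro sum.cong refl sum.mono_neutral_right) auto
  also have "\<dots> = qform B Z v"
    unfolding qform_def using assms by (intro sum.mono_neutral_right) auto
  finally show ?thesis .
qed

text \<open>Points are added in increasing order. The weight of a new maximum is the increment of
  \<open>h\<close> from the previous maximum, or the whole value of \<open>h\<close> if there is
  none; earlier partial sums are unaffected.\<close>

lemma ex_positive_increments:
  fixes h :: "'a::linorder \<Rightarrow> real"
  assumes "finite P" "\<And>x. h x > 0" "strict_mono h"
  shows "\<exists>c. (\<forall>p\<in>P. c p > 0) \<and> (\<forall>m\<in>P. (\<Sum>p | p \<in> P \<and> p \<le> m. c p) = h m)"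
  using assms(1)
proof (induction rule: finite_linorder_max_induct)
  case empty
  show ?case by simp
next
  case (insert b P)
  then obtain c where c: "\<And>p. p \<in> P \<Longrightarrow> c p > 0"
    "\<And>m. m \<in> P \<Longrightarrow> (\<Sum>p | p \<in> P \<and> p \<le> m. c p) = h m" by blast
  define c' where "c' = c(b := h b - sum c P)"
  have b: "b \<notin> P" using insert by auto
  have "sum c P < h b"
  proof (cases "P = {}")
    case False
    have M: "Max P \<in> P" using False insert by simp
    have "P = {p. p \<in> P \<and> p \<le> Max P}" using insert by auto
    then have "sum c P = h (Max P)" using c(2)[OF M] by simp
    also have "\<dots> < h b" using assms(3) M insert by (simp add: strict_mono_def)
    finally show ?thesis .
  qed (simp add: assms)
  then have 1: "\<forall>p\<in>insert b P. c' p > 0"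
    using c by (auto simp: c'_def)
  have 2: "(\<Sum>p | p \<in> insert b P \<and> p \<le> m. c' p) = h m" if m: "m \<in> insert b P" for m
  proof (cases "m = b")
    case True
    have "{p. p \<in> insert b P \<and> p \<le> m} = insert b P" using insert True by auto
    moreover have "sum c' P = sum c P" using b by (intro sum.cong) (auto simp: c'_def)
    ultimately show ?thesis using insert b True by (simp add: c'_def)
  next
    case False
    then have m: "m \<in> P" using m by auto
    then have "{p. p \<in> insert b P \<and> p \<le> m} = {p. p \<in> P \<and> p \<le> m}" using insert by force
    moreover have "(\<Sum>p | p \<in> P \<and> p \<le> m. c' p) = (\<Sum>p | p \<in> P \<and> p \<le> m. c p)"
      using b by (intro sum.cong) (auto simp: c'_def)
    ultimately show ?thesis using c(2)[OF m] by simp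
  qed
  from 1 2 show ?case by blast
qed

text \<open>Since \<open>- \<bar>r - s\<bar> = 2 * min r s - r - s\<close>, the kernel \<open>exp (- \<bar>r - s\<bar>)\<close> is, up to the diagonal factors
  \<open>exp (- r)\<close> and \<open>exp (- s)\<close>, a positive combination of the rank-one kernels \<open>[p \<le> r] [p \<le> s]\<close>.\<close>

lemma laplace_kernel_decomposition:
  fixes u :: "'a \<Rightarrow> real"
  assumes "finite A"
  obtains c where "\<And>p. p \<in> u ` A \<Longrightarrow> c p > 0"
    and "\<And>R v. qform A (\<lambda>x y. exp (- \<bar>u x - u y\<bar>) * R x y) v =
      (\<Sum>p\<in>u ` A. c p * qform A R (\<lambda>x. if p \<le> u x then v x * exp (- u x) else 0))"
proof -
  have "\<exists>c. (\<forall>p\<in>u ` A. c p > 0) \<and> (\<forall>m\<in>u ` A. (\<Sum>p | p \<in> u ` A \<and> p \<le> m. c p) = exp (2 * m))"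
    by (rule ex_positive_increments) (simp_all add: assms strict_mono_def)
  then obtain c where c_pos: "\<forall>p\<in>u ` A. c p > 0"
    and c_sum: "\<forall>m\<in>u ` A. (\<Sum>p | p \<in> u ` A \<and> p \<le> m. c p) = exp (2 * m)"
    by (elim exE conjE)
  have "qform A (\<lambda>x y. exp (- \<bar>u x - u y\<bar>) * R x y) v =
      (\<Sum>p\<in>u ` A. c p * qform A R (\<lambda>x. if p \<le> u x then v x * exp (- u x) else 0))" for R v
  proof -
    define w where "w p x = (if p \<le> u x then v x * exp (- u x) else 0)" for p x
    have eq: "v x * (exp (- \<bar>u x - u y\<bar>) * R x y) * v y = (\<Sum>p\<in>u ` A. c p * (w p x * R x y * w p y))"
      if xy: "x \<in> A" "y \<in> A" for x y
    proof -
      have m: "min (u x) (u y) \<in> u ` A" using xy by (auto simp: min_def)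
      have "(\<Sum>p\<in>u ` A. c p * (w p x * R x y * w p y)) =
        (\<Sum>p\<in>u ` A. if p \<le> min (u x) (u y) then c p * (v x * exp (- u x) * R x y * (v y * exp (- u y))) else 0)"
        by (intro sum.cong) (auto simp: w_def)
      also have "\<dots> = (\<Sum>p | p \<in> u ` A \<and> p \<le> min (u x) (u y).
          c p * (v x * exp (- u x) * R x y * (v y * exp (- u y))))"
        by (rule sum.inter_filter[symmetric]) (simp add: assms)
      also have "\<dots> = exp (2 * min (u x) (u y)) * (v x * exp (- u x) * R x y * (v y * exp (- u y)))"
        by (simp only: bspec[OF c_sum m] sum_distrib_right[symmetric])
      also have "\<dots> = exp (2 * min (u x) (u y) + (- u x) + (- u y)) * (v x * R x y * v y)"
        unfolding exp_add by (simp only: mult_ac)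
      also have "2 * min (u x) (u y) + (- u x) + (- u y) = - \<bar>u x - u y\<bar>"
        by (simp add: min_def)
      finally show ?thesis by (simp add: mult_ac)
    qed
    have "qform A (\<lambda>x y. exp (- \<bar>u x - u y\<bar>) * R x y) v =
       (\<Sum>x\<in>A. \<Sum>y\<in>A. \<Sum>p\<in>u ` A. c p * (w p x * R x y * w p y))"
      unfolding qform_def by (intro sum.cong refl eq)
    also have "\<dots> = (\<Sum>x\<in>A. \<Sum>p\<in>u ` A. \<Sum>y\<in>A. c p * (w p x * R x y * w p y))"
      by (intro sum.cong refl sum.swap)
    also have "\<dots> = (\<Sum>p\<in>u ` A. \<Sum>x\<in>A. \<Sum>y\<in>A. c p * (w p x * R x y * w p y))"
      by (rule sum.swap)
    also have "\<dots> = (\<Sum>p\<in>u ` A. c p * qform A R (w p))"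
      by (simp add: qform_def sum_distrib_left)
    finally show ?thesis unfolding w_def .
  qed
  with bspec[OF c_pos] show ?thesis by (rule that)
qed

text \<open>A case of the Schur product theorem: the decomposition leaves a positive combination of
  values of the form of \<open>R\<close> at truncated and rescaled vectors.\<close>

lemma qform_laplace_mult_nonneg:
  fixes u :: "'a \<Rightarrow> real"
  assumes "finite A" "\<And>v. qform A R v \<ge> 0"
  shows "qform A (\<lambda>x y. exp (- \<bar>u x - u y\<bar>) * R x y) v \<ge> 0"
proof -
  obtain c where c: "\<And>p. p \<in> u ` A \<Longrightarrow> c p > 0"
    "\<And>R v. qform A (\<lambda>x y. exp (- \<bar>u x - u y\<bar>) * R x y) v =
      (\<Sum>p\<in>u ` A. c p * qform A R (\<lambda>x. if p \<le> u x then v x * exp (- u x) else 0))"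
    by (rule laplace_kernel_decomposition[of A u, OF assms(1)]) (rule that)
  show ?thesis
    unfolding c(2) using c(1) assms(2) by (intro sum_nonneg mult_nonneg_nonneg) (auto intro: less_imp_le)
qed

section \<open>Positive definiteness of \<open>exp (- norm (x - y))\<close> and negative
  type\<close>

lemma ell1_sums_norm: "(\<lambda>i. \<bar>coord x i\<bar>) sums norm x"
  using summable_sums[OF summable_coord] by (simp add: norm_ell1.rep_eq)

lemma coord_remove: "coord (x - coord x i *\<^sub>R unit_ell1 i) j = (if j = i then 0 else coord x j)"
  by (simp add: minus_ell1.rep_eq scaleR_ell1.rep_eq unit_ell1.rep_eq)

lemma norm_ell1_split: "norm x = \<bar>coord x i\<bar> + norm (x - coord x i *\<^sub>R unit_ell1 i)"
proof -
  have "(\<lambda>j. (if j = i then \<bar>coord x j\<bar> else 0) + \<bar>coord (x - coord x i *\<^sub>R unit_ell1 i) j\<bar>)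
    sums (\<bar>coord x i\<bar> + norm (x - coord x i *\<^sub>R unit_ell1 i))"
    by (intro sums_add ell1_sums_norm sums_single)
  moreover have "(\<lambda>j. (if j = i then \<bar>coord x j\<bar> else 0) + \<bar>coord (x - coord x i *\<^sub>R unit_ell1 i) j\<bar>)
      = (\<lambda>j. \<bar>coord x j\<bar>)"
    by (auto simp: coord_remove)
  ultimately show ?thesis using ell1_sums_norm sums_unique2 by metis
qed

text \<open>Indexing by \<open>\<phi>\<close> allows repeated points: the strict version below
  applies this after deleting a coordinate, which may identify points.\<close>

lemma qform_exp_norm_nonneg:
  fixes \<phi> :: "'a \<Rightarrow> ell1"
  assumes A: "finite A"
  shows "qform A (\<lambda>x y. exp (- norm (\<phi> x - \<phi> y))) v \<ge> 0"
proof -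
  define Z where "Z n x y = exp (- (\<Sum>i<n. \<bar>coord (\<phi> x) i - coord (\<phi> y) i\<bar>))" for n :: nat and x y
  have "qform A (Z n) v \<ge> 0" for n v
  proof (induction n arbitrary: v)
    case 0
    have "qform A (Z 0) v = (\<Sum>x\<in>A. v x)\<^sup>2"
      by (simp add: qform_def Z_def power2_eq_square sum_product)
    then show ?case by simp
  next
    case (Suc n)
    have "Z (Suc n) = (\<lambda>x y. exp (- \<bar>coord (\<phi> x) n - coord (\<phi> y) n\<bar>) * Z n x y)"
      by (simp add: Z_def fun_eq_iff exp_add[symmetric])
    then show ?case
      using qform_laplace_mult_nonneg[OF A Suc.IH] by simp
  qed
  moreover have "(\<lambda>n. qform A (Z n) v) \<longlonglongrightarrow> qform A (\<lambda>x y. exp (- norm (\<phi> x - \<phi> y))) v"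
    unfolding qform_def Z_def
    using ell1_sums_norm[of "\<phi> _ - \<phi> _"]
    by (intro tendsto_intros) (simp add: sums_def minus_ell1.rep_eq)
  ultimately show ?thesis
    by (intro LIMSEQ_le_const) auto
qed

text \<open>Strictness need not survive the limit over coordinates, hence a separate induction.
  Demanding that \<open>v\<close> vanish nowhere on \<open>A\<close> gives a condition that passes
  to subsets.\<close>

lemma qform_exp_norm_pos:
  fixes \<phi> :: "'a \<Rightarrow> ell1"
  assumes "finite A" "inj_on \<phi> A" "\<And>x. x \<in> A \<Longrightarrow> v x \<noteq> 0" "A \<noteq> {}"
  shows "qform A (\<lambda>x y. exp (- norm (\<phi> x - \<phi> y))) v > 0"
  using assms
proof (induction A arbitrary: v rule: finite_psubset_induct)
  case (psubset A)
  let ?K = "\<lambda>x y. exp (- norm (\<phi> x - \<phi> y))"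
  obtain x where x: "x \<in> A" using psubset by auto
  txt \<open>Split off a coordinate \<open>u\<close> that is not constant on \<open>A\<close>. The rank-one term of the largest value \<open>m\<close>
    of \<open>u\<close> only sees the proper subset where \<open>u = m\<close>, on which \<open>R\<close> agrees with the full kernel.\<close>
  show ?case
  proof (cases "A = {x}")
    case True
    then show ?thesis using psubset.prems(2)[OF x]
      by (simp add: qform_def) (metis not_real_square_gt_zero)
  next
    case False
    then obtain y where y: "y \<in> A" "y \<noteq> x" using x by auto
    then have "\<phi> y \<noteq> \<phi> x" using psubset.prems(1) x by (auto dest: inj_onD)
    then obtain i where i: "coord (\<phi> y) i \<noteq> coord (\<phi> x) i" using ell1_eqI by blast
    define u where "u z = coord (\<phi> z) i" for z
    define \<psi> where "\<psi> z = \<phi> z - u z *\<^sub>R unit_ell1 i" for z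
    define R where "R = (\<lambda>x y. exp (- norm (\<psi> x - \<psi> y)))"
    have norm_eq: "norm (\<phi> z - \<phi> z') = \<bar>u z - u z'\<bar> + norm (\<psi> z - \<psi> z')" for z z'
      using norm_ell1_split[of "\<phi> z - \<phi> z'" i]
      by (simp add: u_def \<psi>_def minus_ell1.rep_eq algebra_simps)
    have K: "?K = (\<lambda>x y. exp (- \<bar>u x - u y\<bar>) * R x y)"
      by (simp add: norm_eq R_def exp_add[symmetric])
    obtain c where c: "\<And>p. p \<in> u ` A \<Longrightarrow> c p > 0"
      "\<And>R v. qform A (\<lambda>x y. exp (- \<bar>u x - u y\<bar>) * R x y) v =
        (\<Sum>p\<in>u ` A. c p * qform A R (\<lambda>x. if p \<le> u x then v x * exp (- u x) else 0))"
      by (rule laplace_kernel_decomposition[of A u, OF psubset.hyps(1)]) (rule that)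
    define w where "w p z = (if p \<le> u z then v z * exp (- u z) else 0)" for p z
    define m where "m = Max (u ` A)"
    have m: "m \<in> u ` A" and le: "\<And>z. z \<in> A \<Longrightarrow> u z \<le> m"
      using psubset.hyps(1) x unfolding m_def by (auto intro: Max_in)
    define B where "B = {z \<in> A. u z = m}"
    have "B \<noteq> A"
    proof
      assume "B = A"
      then have "x \<in> B" "y \<in> B" using x y by auto
      then show False using i by (simp add: B_def u_def)
    qed
    then have B: "B \<subset> A" "B \<noteq> {}"
      using m by (auto simp: B_def)
    have "qform A R (w m) = qform B R (w m)"
      using psubset.hyps(1) le by (intro qform_support) (force simp: B_def w_def)+
    also have "\<dots> = qform B ?K (w m)"
      by (intro qform_cong) (simp add: norm_eq R_def B_def)
    also have "\<dots> > 0"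
      using B psubset.prems(1,2) by (intro psubset.IH) (auto simp: B_def w_def intro: inj_on_subset)
    finally have pos: "qform A R (w m) > 0" .
    have "qform A ?K v = (\<Sum>p\<in>u ` A. c p * qform A R (w p))"
      unfolding K c(2) w_def ..
    also have "\<dots> > 0"
    \<comment> \<open>The term at \<open>m\<close> is positive; the others are non-negative by the
      semidefinite bound for the points \<open>\<psi>\<close>, which lack coordinate
      \<open>i\<close>.\<close>
    proof (rule sum_pos2)
      show "0 < c m * qform A R (w m)" using pos c(1)[OF m] by simp
      show "0 \<le> c p * qform A R (w p)" if "p \<in> u ` A" for p
        using c(1)[OF that] qform_exp_norm_nonneg[OF psubset.hyps(1)] unfolding R_def by simp
    qed (use m psubset.hyps(1) in auto)
    finally show ?thesis .
  qed
qed

lemma negative_type_submetric_ell1: "negative_type (submetric euclidean_metric (S :: ell1 set))"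
  unfolding negative_type_def positive_definite_space_def
proof (intro allI impI)
  fix t :: real and A :: "ell1 set"
  assume t: "t > 0" and A: "finite A \<and> A \<subseteq> mspace (rescale t (submetric euclidean_metric S))"
  \<comment> \<open>Scaling the metric by \<open>t\<close> amounts to scaling the points, so every
    \<open>t\<close> reduces to the unscaled kernel.\<close>
  have sim: "similarity_matrix (rescale t (submetric euclidean_metric S)) x y = exp (- norm (t *\<^sub>R x - t *\<^sub>R y))" for x y
    using t by (simp add: similarity_matrix_def mdist_rescale dist_norm scaleR_diff_right[symmetric])
  show "pos_def_on A (similarity_matrix (rescale t (submetric euclidean_metric S)))"
    unfolding pos_def_on_def sim
  proof (intro conjI allI impI ballI)
    fix v :: "ell1 \<Rightarrow> real" assume v: "\<exists>a\<in>A. v a \<noteq> 0"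
    let ?Z = "\<lambda>x y. exp (- norm (t *\<^sub>R x - t *\<^sub>R y))" and ?B = "{a \<in> A. v a \<noteq> 0}"
    have "qform ?B ?Z v > 0"
      using A v t by (intro qform_exp_norm_pos) (auto simp: inj_on_def)
    also have "qform ?B ?Z v = qform A ?Z v"
      using A by (intro qform_support[symmetric]) auto
    finally show "(\<Sum>a\<in>A. \<Sum>b\<in>A. v a * ?Z a b * v b) > 0" by (simp add: qform_def)
  qed (simp add: norm_minus_commute)
qed

section \<open>Similarity matrices of weighted stars and their inverses\<close>

text \<open>Inverses are unique, so the one picked by \<open>SOME\<close> can be replaced by an
  explicit one, transported along \<open>\<phi>\<close>.\<close>

lemma finite_magnitude_image:
  assumes I: "finite I" "inj_on \<phi> I"
    and V: "inverse_on I (\<lambda>i j. similarity_matrix m (\<phi> i) (\<phi> j)) V"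
  shows "finite_magnitude m (\<phi> ` I) = (\<Sum>i\<in>I. \<Sum>j\<in>I. V i j)"
proof -
  let ?Z = "similarity_matrix m"
  define W where "W x y = V (inv_into I \<phi> x) (inv_into I \<phi> y)" for x y
  define U where "U = (SOME U. inverse_on (\<phi> ` I) ?Z U)"
  have W: "inverse_on (\<phi> ` I) ?Z W"
    using V I(2) unfolding inverse_on_def
    by (auto simp: W_def sum.reindex inj_on_eq_iff)
  then have "inverse_on (\<phi> ` I) ?Z U" unfolding U_def by (rule someI[of "inverse_on (\<phi> ` I) ?Z"])
  then have UW: "U x y = W x y" if "x \<in> \<phi> ` I" "y \<in> \<phi> ` I" for x y
    using inverse_on_unique[OF _ _ W that] I(1) by blast
  have "finite_magnitude m (\<phi> ` I) = (\<Sum>x\<in>\<phi> ` I. \<Sum>y\<in>\<phi> ` I. W x y)"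
    unfolding finite_magnitude_def U_def[symmetric] Let_def by (intro sum.cong refl UW)
  then show ?thesis using I(2) by (simp add: sum.reindex W_def)
qed

text \<open>The similarity matrix of a weighted star: index \<open>0\<close> is the centre, \<open>d i\<close> is the similarity of
  \<open>i\<close> to the centre, and in particular \<open>d 0 = 1\<close>.\<close>

definition star_matrix :: "(nat \<Rightarrow> real) \<Rightarrow> nat \<Rightarrow> nat \<Rightarrow> real"
  where "star_matrix d i j = (if i = j then 1 else d i * d j)"

text \<open>Obtained by block elimination of the centre: when \<open>d 0 = 1\<close>, the Schur
  complement of the centre entry is diagonal with entries \<open>1 - (d i)\<^sup>2\<close>.\<close>

definition star_inverse :: "nat \<Rightarrow> (nat \<Rightarrow> real) \<Rightarrow> nat \<Rightarrow> nat \<Rightarrow> real"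
  where "star_inverse n d i j =
    (if i = 0 \<and> j = 0 then 1 + (\<Sum>k<n. (d (Suc k))\<^sup>2 / (1 - (d (Suc k))\<^sup>2))
     else if i = 0 then - d j / (1 - (d j)\<^sup>2)
     else if j = 0 then - d i / (1 - (d i)\<^sup>2)
     else if i = j then 1 / (1 - (d i)\<^sup>2) else 0)"

lemma star_matrix_mult_inverse:
  assumes d: "d 0 = 1" "\<And>i. i < n \<Longrightarrow> (d (Suc i))\<^sup>2 \<noteq> 1" and ij: "i < Suc n" "j < Suc n"
  shows "(\<Sum>c<Suc n. star_matrix d i c * star_inverse n d c j) = (if i = j then 1 else 0)"
proof -
  let ?Z = "star_matrix d" and ?V = "star_inverse n d"
  define s where "s k = (d (Suc k))\<^sup>2 / (1 - (d (Suc k))\<^sup>2)" for k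
  have split: "(\<Sum>c<Suc n. ?Z i c * ?V c j) = ?Z i 0 * ?V 0 j + (\<Sum>k<n. ?Z i (Suc k) * ?V (Suc k) j)"
    by (rule sum.lessThan_Suc_shift)
  show ?thesis
  proof (cases j)
    case (Suc l)
    have l: "l < n" using ij Suc by simp
    \<comment> \<open>Outside row 0, column \<open>j\<close> of the inverse has only its diagonal
      entry.\<close>
    have "(\<Sum>k<n. ?Z i (Suc k) * ?V (Suc k) j) = (\<Sum>k<n. if k = l then ?Z i (Suc l) * ?V (Suc l) j else 0)"
      by (intro sum.cong) (auto simp: star_inverse_def Suc)
    also have "\<dots> = ?Z i j / (1 - (d j)\<^sup>2)"
      using l by (simp add: Suc star_inverse_def)
    finally have "(\<Sum>c<Suc n. ?Z i c * ?V c j) = (?Z i j - ?Z i 0 * d j) / (1 - (d j)\<^sup>2)"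
      unfolding split by (simp add: star_inverse_def Suc diff_divide_distrib)
    then show ?thesis
      using d l Suc by (auto simp: star_matrix_def power2_eq_square)
  next
    case j: 0
    show ?thesis
    proof (cases i)
      case 0
      have "(\<Sum>k<n. ?Z i (Suc k) * ?V (Suc k) j) = - (\<Sum>k<n. s k)"
        unfolding sum_negf[symmetric]
        by (intro sum.cong) (auto simp: star_matrix_def star_inverse_def 0 j d s_def power2_eq_square)
      then show ?thesis unfolding split by (simp add: star_matrix_def star_inverse_def 0 j s_def)
    next
      case (Suc l)
      have l: "l < n" using ij Suc by simp
      let ?e = "d (Suc l)"
      have e: "1 - ?e\<^sup>2 \<noteq> 0" using d l by auto
      \<comment> \<open>The off-diagonal pattern \<open>- ?e * s k\<close> fails only at
        \<open>k = l\<close>, where \<open>star_matrix\<close> has entry 1; the conditional term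
        corrects this.\<close>
      have "(\<Sum>k<n. ?Z i (Suc k) * ?V (Suc k) j)
        = (\<Sum>k<n. - ?e * s k + (if k = l then ?e * s l - ?e / (1 - ?e\<^sup>2) else 0))"
        by (intro sum.cong)
          (auto simp: star_matrix_def star_inverse_def Suc j s_def power2_eq_square)
      also have "\<dots> = - ?e * (\<Sum>k<n. s k) + (?e * s l - ?e / (1 - ?e\<^sup>2))"
        using l by (simp add: sum.distrib sum_distrib_left sum_negf sum_subtractf)
      also have "?e * s l - ?e / (1 - ?e\<^sup>2) = - ?e"
        using e unfolding s_def by (simp add: divide_simps) algebra
      finally show ?thesis
        unfolding split by (simp add: star_matrix_def star_inverse_def Suc j d s_def algebra_simps)
    qed
  qed
qed

lemma inverse_on_star:
  assumes "d 0 = 1" "\<And>i. i < n \<Longrightarrow> (d (Suc i))\<^sup>2 \<noteq> 1"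
  shows "inverse_on {..<Suc n} (star_matrix d) (star_inverse n d)"
proof -
  \<comment> \<open>Both matrices are symmetric, so transposing the right-inverse identity gives the
    left one.\<close>
  have sym: "star_matrix d i j = star_matrix d j i" "star_inverse n d i j = star_inverse n d j i" for i j
    by (auto simp: star_matrix_def star_inverse_def)
  have "(\<Sum>c<Suc n. star_inverse n d i c * star_matrix d c j) = (if i = j then 1 else 0)"
    if "i < Suc n" "j < Suc n" for i j
    using star_matrix_mult_inverse[OF assms that(2,1)]
    by (simp add: sym[of i] sym[of _ j] mult.commute eq_commute[of i j] del: sum.lessThan_Suc)
  then show ?thesis
    using star_matrix_mult_inverse[OF assms] unfolding inverse_on_def by blast
qed

text \<open>With \<open>e = d (Suc k)\<close>, leaf \<open>k\<close> contributes
  \<open>e\<^sup>2\<close> to the corner, \<open>- e\<close> to each of row 0 and column 0, and 1 to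
  the diagonal, all over \<open>1 - e\<^sup>2\<close>. The total is
  \<open>(1 - e)\<^sup>2 / (1 - e\<^sup>2)\<close>.\<close>

lemma sum_star_inverse:
  assumes "\<And>i. i < n \<Longrightarrow> (d (Suc i))\<^sup>2 \<noteq> 1"
  shows "(\<Sum>i<Suc n. \<Sum>j<Suc n. star_inverse n d i j)
    = 1 + (\<Sum>k<n. (1 - d (Suc k)) / (1 + d (Suc k)))"
proof -
  let ?V = "star_inverse n d"
  have row: "(\<Sum>j<Suc n. ?V (Suc i) j) = (1 - d (Suc i)) / (1 - (d (Suc i))\<^sup>2)" if "i < n" for i
  proof -
    have "(\<Sum>j<n. ?V (Suc i) (Suc j)) = (\<Sum>j<n. if i = j then 1 / (1 - (d (Suc i))\<^sup>2) else 0)"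
      by (intro sum.cong) (auto simp: star_inverse_def)
    then show ?thesis
      unfolding sum.lessThan_Suc_shift using that
      by (simp add: star_inverse_def diff_divide_distrib)
  qed
  have "(\<Sum>i<Suc n. \<Sum>j<Suc n. ?V i j) = (\<Sum>j<Suc n. ?V 0 j) + (\<Sum>i<n. \<Sum>j<Suc n. ?V (Suc i) j)"
    by (rule sum.lessThan_Suc_shift)
  also have "(\<Sum>i<n. \<Sum>j<Suc n. ?V (Suc i) j) = (\<Sum>i<n. (1 - d (Suc i)) / (1 - (d (Suc i))\<^sup>2))"
    by (intro sum.cong refl row) simp
  also have "(\<Sum>j<Suc n. ?V 0 j) = 1 + (\<Sum>k<n. (d (Suc k))\<^sup>2 / (1 - (d (Suc k))\<^sup>2))
      + (\<Sum>k<n. - d (Suc k) / (1 - (d (Suc k))\<^sup>2))"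
    unfolding sum.lessThan_Suc_shift by (simp add: star_inverse_def)
  finally have "(\<Sum>i<Suc n. \<Sum>j<Suc n. ?V i j) = 1 + (\<Sum>k<n. (d (Suc k))\<^sup>2 / (1 - (d (Suc k))\<^sup>2)
     + - d (Suc k) / (1 - (d (Suc k))\<^sup>2) + (1 - d (Suc k)) / (1 - (d (Suc k))\<^sup>2))"
    by (simp only: sum.distrib add.assoc)
  also have "\<dots> = 1 + (\<Sum>k<n. (1 - d (Suc k)) / (1 + d (Suc k)))"
  proof (intro arg_cong[of _ _ "\<lambda>x. 1 + x"] sum.cong refl)
    fix k assume "k \<in> {..<n}"
    then have *: "(d (Suc k))\<^sup>2 \<noteq> 1" using assms by simp
    let ?e = "d (Suc k)"
    from * have "?e \<noteq> -1" by auto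
    then have "1 + ?e \<noteq> 0" "1 - ?e\<^sup>2 \<noteq> 0" using * by auto
    then show "?e\<^sup>2 / (1 - ?e\<^sup>2) + - ?e / (1 - ?e\<^sup>2) + (1 - ?e) / (1 - ?e\<^sup>2) = (1 - ?e) / (1 + ?e)"
      by (simp add: divide_simps) algebra
  qed
  finally show ?thesis .
qed

section \<open>Stars formed by the origin and scaled unit vectors, and the divergence of their
  magnitudes\<close>

lemma norm_scaled_unit: "norm (c *\<^sub>R unit_ell1 i) = \<bar>c\<bar>"
proof -
  have "(\<lambda>j. if j = i then \<bar>c\<bar> else 0) sums \<bar>c\<bar>" using sums_single[of i "\<lambda>_. \<bar>c\<bar>"] by simp
  moreover have "(\<lambda>j. if j = i then \<bar>c\<bar> else 0) = (\<lambda>j. \<bar>coord (c *\<^sub>R unit_ell1 i) j\<bar>)"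
    by (auto simp: scaleR_ell1.rep_eq unit_ell1.rep_eq)
  ultimately show ?thesis using ell1_sums_norm sums_unique2 by metis
qed

lemma norm_unit: "norm (unit_ell1 i) = 1"
  using norm_scaled_unit[of 1 i] by simp

lemma norm_diff_scaled_units:
  assumes "i \<noteq> j"
  shows "norm (c *\<^sub>R unit_ell1 i - c' *\<^sub>R unit_ell1 j) = \<bar>c\<bar> + \<bar>c'\<bar>"
proof -
  have "coord (c *\<^sub>R unit_ell1 i - c' *\<^sub>R unit_ell1 j) i = c"
    using assms by (simp add: minus_ell1.rep_eq scaleR_ell1.rep_eq unit_ell1.rep_eq)
  then show ?thesis
    using norm_ell1_split[of "c *\<^sub>R unit_ell1 i - c' *\<^sub>R unit_ell1 j" i] norm_scaled_unit[of "- c'" j]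
    by simp
qed

lemma finite_magnitude_star:
  fixes a :: "nat \<Rightarrow> real" and t :: real and S :: "ell1 set"
  assumes a: "\<And>i. a i > 0" and t: "t > 0"
  defines "q \<equiv> \<lambda>i. exp (- (t * a i))"
  shows "finite_magnitude (rescale t (submetric euclidean_metric S))
      (insert 0 ((\<lambda>i. a i *\<^sub>R unit_ell1 i) ` {..<n}))
    = 1 + (\<Sum>i<n. (1 - q i) / (1 + q i))"
proof -
  let ?m = "rescale t (submetric euclidean_metric S)"
  define \<phi> :: "nat \<Rightarrow> ell1" where "\<phi> = case_nat 0 (\<lambda>i. a i *\<^sub>R unit_ell1 i)"
  define d where "d = case_nat 1 q"
  \<comment> \<open>Index 0 is the origin and \<open>Suc i\<close> the vertex of length
    \<open>a i\<close>. Giving the centre length 0 lets one formula cover centre-leaf and leaf-leaf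
    distances.\<close>
  have dist: "norm (\<phi> i - \<phi> j) = (if i = j then 0 else case_nat 0 a i + case_nat 0 a j)" for i j
    using a by (auto simp: \<phi>_def norm_unit norm_diff_scaled_units abs_of_pos split: nat.split)
  have pos: "i \<noteq> j \<Longrightarrow> case_nat 0 a i + case_nat 0 a j > 0" for i j
    using a by (auto simp: add_pos_pos split: nat.split)
  have "inj \<phi>"
    by (rule injI, rule ccontr) (use dist pos in \<open>metis diff_self norm_zero less_irrefl\<close>)
  then have inj: "inj_on \<phi> {..<Suc n}" by (rule inj_on_subset) simp
  have Z: "(\<lambda>i j. similarity_matrix ?m (\<phi> i) (\<phi> j)) = star_matrix d"
  proof (intro ext)
    fix i j
    show "similarity_matrix ?m (\<phi> i) (\<phi> j) = star_matrix d i j"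
      using t by (auto simp: similarity_matrix_def mdist_rescale dist_norm dist star_matrix_def d_def q_def
          exp_add[symmetric] algebra_simps split: nat.split)
  qed
  have "q i \<noteq> 1" "q i > 0" for i using a[of i] t by (auto simp: q_def)
  then have d: "d 0 = 1" "(d (Suc i))\<^sup>2 \<noteq> 1" for i
    by (auto simp: d_def power2_eq_1_iff) (metis less_asym neg_less_0_iff_less zero_less_one)
  have "insert 0 ((\<lambda>i. a i *\<^sub>R unit_ell1 i) ` {..<n}) = \<phi> ` {..<Suc n}"
    by (simp add: lessThan_Suc_eq_insert_0 image_image \<phi>_def)
  then have "finite_magnitude ?m (insert 0 ((\<lambda>i. a i *\<^sub>R unit_ell1 i) ` {..<n}))
     = (\<Sum>i<Suc n. \<Sum>j<Suc n. star_inverse n d i j)"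
    using finite_magnitude_image[OF _ inj, of ?m] inverse_on_star[of d n, OF d] unfolding Z by simp
  also have "\<dots> = 1 + (\<Sum>i<n. (1 - q i) / (1 + q i))"
    using sum_star_inverse[of n d, OF d(2)] by (simp add: d_def)
  finally show ?thesis .
qed

text \<open>The quotient is \<open>tanh (x / 2)\<close>. Its numerator is at least
  \<open>x / 2\<close>, by \<open>1 + x \<le> exp x\<close> and \<open>x \<le> 1\<close>, and its
  denominator is at most 2.\<close>

lemma one_minus_exp_ratio_ge:
  fixes x :: real
  assumes "0 \<le> x" "x \<le> 1"
  shows "x / 4 \<le> (1 - exp (- x)) / (1 + exp (- x))"
proof -
  have "exp (- x) \<le> 1 / (1 + x)"
    using exp_ge_add_one_self[of x] assms by (simp add: exp_minus divide_simps)
  also have "\<dots> \<le> 1 - x / 2"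
    using assms mult_left_le[of x x] by (simp add: field_simps)
  finally have "x / 2 \<le> 1 - exp (- x)" by simp
  then have "(x / 2) / 2 \<le> (1 - exp (- x)) / (1 + exp (- x))"
    using assms by (intro frac_le) (auto intro: add_pos_pos)
  then show ?thesis by simp
qed

lemma magnitude_eq_PInfty:
  fixes a :: "nat \<Rightarrow> real" and S :: "ell1 set"
  assumes a: "\<And>i. a i > 0" and lim: "a \<longlonglongrightarrow> 0" and div: "\<not> summable a" and t: "t > 0"
    and S: "0 \<in> S" "\<And>i. a i *\<^sub>R unit_ell1 i \<in> S"
  shows "magnitude (rescale t (submetric euclidean_metric S)) = \<infinity>"
proof -
  let ?m = "rescale t (submetric euclidean_metric S)"
  define f where "f i = (1 - exp (- (t * a i))) / (1 + exp (- (t * a i)))" for i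
  have f0: "f i \<ge> 0" for i
    using a[of i] t unfolding f_def by (intro divide_nonneg_pos) (auto intro: add_pos_pos less_imp_le)
  have "\<not> summable f"
  proof
    assume "summable f"
    have "(\<lambda>i. t * a i) \<longlonglongrightarrow> t * 0" by (intro tendsto_intros lim)
    then have "\<forall>\<^sub>F i in sequentially. t * a i < 1" by (rule order_tendstoD) simp
    \<comment> \<open>On the tail \<open>t * a i\<close> is below 1, so the linear lower bound on
      \<open>f\<close> applies; \<open>4 / t\<close> is its constant inverted.\<close>
    then have "\<forall>\<^sub>F i in sequentially. norm (a i) \<le> 4 / t * f i"
    proof eventually_elim
      case (elim i)
      have "t * a i / 4 \<le> f i"
        using one_minus_exp_ratio_ge[of "t * a i"] elim a[of i] t by (simp add: f_def)
      then show ?case using a[of i] t by (simp add: field_simps)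
    qed
    then have "summable a"
      by (rule summable_comparison_test_ev) (intro summable_mult \<open>summable f\<close>)
    with div show False ..
  qed
  have "ereal B \<le> magnitude ?m" for B
  proof -
    obtain n where n: "(\<Sum>i<n. f i) > B"
      using \<open>\<not> summable f\<close> summableI_nonneg_bounded[of f B] f0 by (meson not_le)
    let ?A = "insert 0 ((\<lambda>i. a i *\<^sub>R unit_ell1 i) ` {..<n})"
    have "ereal B \<le> ereal (finite_magnitude ?m ?A)"
      using n unfolding finite_magnitude_star[OF a t] f_def by simp
    also have "\<dots> \<le> magnitude ?m"
      unfolding magnitude_def using S t by (intro SUP_upper) (auto simp: mspace_rescale)
    finally show ?thesis .
  qed
  then show ?thesis by (rule ereal_top)
qed

section \<open>Compactness of the closed convex hull\<close>

text \<open>A closed subset of a Tychonoff cube: bounding partial sums instead of the series makes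
  each condition depend on finitely many coordinates, hence closed.\<close>

lemma compact_partial_sums_le_1:
  "compact {b :: nat \<Rightarrow> real. (\<forall>i. 0 \<le> b i) \<and> (\<forall>n. (\<Sum>i<n. b i) \<le> 1)}" (is "compact ?B")
proof -
  have "compactin (product_topology (\<lambda>_. euclidean) UNIV) (PiE UNIV (\<lambda>_::nat. {0..1::real}))"
    by (simp add: compactin_PiE)
  then have 1: "compact (PiE UNIV (\<lambda>_::nat. {0..1::real}))"
    by (simp add: euclidean_product_topology)
  have 2: "closed ?B"
    by (intro closed_Collect_conj closed_Collect_all closed_Collect_le continuous_intros
        continuous_on_product_coordinates)
  have 3: "?B \<subseteq> PiE UNIV (\<lambda>_. {0..1})"
  proof
    fix b :: "nat \<Rightarrow> real" assume b: "b \<in> ?B"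
    have "b i \<le> 1" for i
    proof -
      have "b i \<le> (\<Sum>k<Suc i. b k)" using b by (simp add: sum_nonneg)
      also have "\<dots> \<le> 1" using b by blast
      finally show ?thesis .
    qed
    with b show "b \<in> PiE UNIV (\<lambda>_. {0..1})" by auto
  qed
  show ?thesis using compact_Int_closed[OF 1 2] 3 by (simp add: Int_absorb1)
qed

lemma compact_closure_hull_scaled_units:
  fixes a :: "nat \<Rightarrow> real"
  assumes a: "\<And>i. a i > 0" and lim: "a \<longlonglongrightarrow> 0"
  shows "compact (closure (convex hull (range (\<lambda>i. a i *\<^sub>R unit_ell1 i))))"
proof -
  \<comment> \<open>Total mass at most 1 rather than equal to 1, since mass can escape to infinity
    in a coordinatewise limit.\<close>
  define B where "B = {b :: nat \<Rightarrow> real. (\<forall>i. 0 \<le> b i) \<and> (\<forall>n. (\<Sum>i<n. b i) \<le> 1)}"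
  \<comment> \<open>\<open>Abs_ell1\<close> is unspecified off the summable sequences;
    \<open>coord_F\<close> confirms the intended values on \<open>B\<close>.\<close>
  define F where "F b = Abs_ell1 (\<lambda>i. a i * b i)" for b
  have sum_b: "summable b" "suminf b \<le> 1" if "b \<in> B" for b
  proof -
    show "summable b" using that by (intro summableI_nonneg_bounded[of _ 1]) (auto simp: B_def)
    then show "suminf b \<le> 1" using that by (intro suminf_le_const) (auto simp: B_def)
  qed
  obtain C where C: "\<And>i. \<bar>a i\<bar> \<le> C"
    using convergent_imp_Bseq[OF convergentI[OF lim]] by (auto simp: Bseq_def)
  have coord_F: "coord (F b) i = a i * b i" if b: "b \<in> B" for b i
  proof -
    have "summable (\<lambda>i. \<bar>a i * b i\<bar>)"
    proof (rule summable_comparison_test)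
      show "\<exists>N. \<forall>i\<ge>N. norm \<bar>a i * b i\<bar> \<le> C * b i"
        using b C by (auto simp: B_def abs_mult intro!: mult_right_mono)
      show "summable (\<lambda>i. C * b i)" using sum_b(1)[OF b] by (rule summable_mult)
    qed
    then show ?thesis unfolding F_def by (subst Abs_ell1_inverse) auto
  qed
  define G where "G n b = (\<Sum>i<n. (a i * b i) *\<^sub>R unit_ell1 i)" for n and b :: "nat \<Rightarrow> real"
  have coord_G: "coord (G n b) j = (if j < n then a j * b j else 0)" for n b j
    by (induction n)
      (auto simp: G_def zero_ell1.rep_eq plus_ell1.rep_eq scaleR_ell1.rep_eq unit_ell1.rep_eq less_Suc_eq)
  have "uniform_limit B G F sequentially"
  proof (rule uniform_limitI)
    \<comment> \<open>Beyond \<open>N\<close> the factors \<open>a i\<close> are below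
      \<open>e / 2\<close>, and \<open>b\<close> has mass at most 1, so the tail has norm at most
      \<open>e / 2\<close> for all \<open>b\<close> in \<open>B\<close> at once.\<close>
    fix e :: real assume e: "e > 0"
    then have "\<forall>\<^sub>F i in sequentially. a i < e / 2" by (intro order_tendstoD(2)[OF lim]) simp
    then obtain N where N: "\<And>i. i \<ge> N \<Longrightarrow> a i < e / 2" by (auto simp: eventually_sequentially)
    show "\<forall>\<^sub>F n in sequentially. \<forall>b\<in>B. dist (G n b) (F b) < e"
    proof (intro eventually_sequentiallyI[of N] ballI)
      fix n b assume n: "N \<le> n" and b: "b \<in> B"
      have b0: "b i \<ge> 0" for i using b by (simp add: B_def)
      have "norm (F b - G n b) \<le> e / 2 * suminf b"
      proof (rule sums_le[OF _ ell1_sums_norm sums_mult[OF summable_sums[OF sum_b(1)[OF b]]]])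
        fix i
        have "a i * b i \<le> e / 2 * b i" if "i \<ge> n"
          using N[of i] that n b0[of i] by (intro mult_right_mono) auto
        then show "\<bar>coord (F b - G n b) i\<bar> \<le> e / 2 * b i"
          using b0[of i] a[of i] e by (auto simp: minus_ell1.rep_eq coord_F[OF b] coord_G)
      qed
      also have "\<dots> \<le> e / 2 * 1" using e sum_b(2)[OF b] by (intro mult_left_mono) auto
      also have "\<dots> < e" using e by simp
      finally show "dist (G n b) (F b) < e" by (simp add: dist_norm norm_minus_commute)
    qed
  qed
  moreover have "continuous_on B (G n)" for n
    unfolding G_def
    by (intro continuous_intros continuous_on_subset[OF continuous_on_product_coordinates]) auto
  ultimately have "continuous_on B F"
    by (intro uniform_limit_theorem[where f = G and F = sequentially]) auto
  then have K: "compact (F ` B)"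
    using compact_partial_sums_le_1 unfolding B_def by (rule compact_continuous_image)
  have "convex (F ` B)"
    unfolding convex_def
  proof (intro ballI allI impI)
    fix x y and u v :: real
    assume x: "x \<in> F ` B" and y: "y \<in> F ` B" and uv: "0 \<le> u" "0 \<le> v" "u + v = 1"
    obtain b where b: "b \<in> B" "x = F b" using x by auto
    obtain c where c: "c \<in> B" "y = F c" using y by auto
    define w where "w = (\<lambda>i. u * b i + v * c i)"
    have "(\<Sum>i<n. w i) \<le> 1" for n
    proof -
      have "(\<Sum>i<n. w i) = u * (\<Sum>i<n. b i) + v * (\<Sum>i<n. c i)"
        by (simp add: w_def sum.distrib sum_distrib_left)
      also have "\<dots> \<le> 1"
        using b c uv by (intro convex_bound_le) (auto simp: B_def)
      finally show ?thesis .
    qed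
    moreover have "w i \<ge> 0" for i using b c uv by (simp add: w_def B_def)
    ultimately have w: "w \<in> B" by (simp add: B_def)
    have "u *\<^sub>R x + v *\<^sub>R y = F w"
      by (rule ell1_eqI)
        (simp add: plus_ell1.rep_eq scaleR_ell1.rep_eq coord_F b c w, simp add: w_def algebra_simps)
    with w show "u *\<^sub>R x + v *\<^sub>R y \<in> F ` B" by blast
  qed
  moreover have "a i *\<^sub>R unit_ell1 i \<in> F ` B" for i
  proof
    show B: "(\<lambda>j. if j = i then 1 else 0) \<in> B" by (simp add: B_def)
    show "a i *\<^sub>R unit_ell1 i = F (\<lambda>j. if j = i then 1 else 0)"
      by (rule ell1_eqI) (simp add: coord_F[OF B] scaleR_ell1.rep_eq unit_ell1.rep_eq)
  qed
  \<comment> \<open>Being convex and containing the vertices, the image contains their hull; being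
    compact, it is closed and contains the closure as well.\<close>
  ultimately have "convex hull (range (\<lambda>i. a i *\<^sub>R unit_ell1 i)) \<subseteq> F ` B"
    by (intro hull_minimal) auto
  then have "closure (convex hull (range (\<lambda>i. a i *\<^sub>R unit_ell1 i))) \<subseteq> F ` B"
    using compact_imp_closed[OF K] by (rule closure_minimal)
  then show ?thesis
    using compact_Int_closed[OF K closed_closure] by (metis Int_absorb1)
qed

theorem theorem2p1:
  fixes a :: "nat \<Rightarrow> real" and X :: "ell1 metric"
  assumes "\<And>i. a i > 0"
    and "a \<longlonglongrightarrow> 0"
    and "(\<Sum>i. ereal (a i)) = \<infinity>"
    and "X = submetric euclidean_metric (closure (convex hull (range (\<lambda>i. a i *\<^sub>R unit_ell1 i))))"
  shows "compact_space (mtopology_of X) \<and> negative_type X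
    \<and> (\<forall>t::real. t > 0 \<longrightarrow> magnitude (rescale t X) = \<infinity>)"
proof (intro conjI allI impI)
  define S where "S = closure (convex hull (range (\<lambda>i. a i *\<^sub>R unit_ell1 i)))"
  have X: "X = submetric euclidean_metric S" by (simp add: assms(4) S_def)
  have vertex: "a i *\<^sub>R unit_ell1 i \<in> S" for i
    unfolding S_def by (meson closure_subset hull_inc range_eqI subsetD)
  have "compact S" unfolding S_def by (rule compact_closure_hull_scaled_units) (fact assms)+
  then show "compact_space (mtopology_of X)"
    by (simp add: X mtopology_of_submetric compact_space_subtopology)
  show "negative_type X" unfolding X by (rule negative_type_submetric_ell1)
  fix t :: real assume t: "t > 0"
  \<comment> \<open>The centre of the stars is the limit of the vertices, so it lies in the closed
    set \<open>S\<close>.\<close>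
  have "(\<lambda>i. norm (a i *\<^sub>R unit_ell1 i)) \<longlonglongrightarrow> 0"
    using assms(1,2) by (simp add: norm_unit abs_of_pos)
  then have "(\<lambda>i. a i *\<^sub>R unit_ell1 i) \<longlonglongrightarrow> 0" by (rule tendsto_norm_zero_cancel)
  then have "0 \<in> S"
    using closed_sequentially[of S "\<lambda>i. a i *\<^sub>R unit_ell1 i" 0] vertex by (simp add: S_def)
  \<comment> \<open>A summable \<open>a\<close> would give the extended-real series a finite
    value.\<close>
  moreover have "\<not> summable a"
    using assms(3) sums_ereal[of a] by (metis PInfty_neq_ereal(1) sums_unique summable_sums)
  ultimately show "magnitude (rescale t X) = \<infinity>"
    unfolding X using assms(1,2) t vertex by (intro magnitude_eq_PInfty)
qed

end
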